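(* Let $L\ge 1$ be an integer and let $X=\sum_{j=1}^{L}|h_j|^2$, where $h_1,\dots,h_L$ are i.i.d. circularly symmetric complex Gaussian random variables with zero mean and unit variance ($\mathcal{CN}(0,1)$). Denote the distribution function of $X$ by $F_X(x)$. For each $n$, let $X_1,\dots,X_n$ be i.i.d. copies of $X$, and let $X_{i_1}\le X_{i_2}\le\cdots\le X_{i_n}$ be their nondecreasing rearrangement (order statistics). Define \[ a_n=\inf\left\{x:\;1-F_X(x)\le \tfrac{1}{n}\right\},\qquad b_n=\frac{\sum_{i=0}^{L-1}\frac{L-i}{i!}a_n^{i}}{\sum_{i=0}^{L-1}\frac{1}{i!}a_n^{i}}, \] and \[ \mu_1^{x}=\int_{-\infty}^{+\infty}x\,d\!\left(e^{-e^{-x}}\right)=0.577216\cdots . \] Then for any fixed positive integer $l$, \[ \lim_{n\to+\infty}\mathrm{E}\left[\frac{\sum_{k=1}^{l}X_{i_{n-k+1}}-l\,a_n}{b_n}\right]=l\left(\mu_1^{x}+1-\sum_{k=1}^{l}\frac{1}{k}\right). \]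
   Context: $\sum_{k=1}^{l}X_{i_{n-k+1}}$ is the sum of the $l$ largest among the $n$ i.i.d. random variables $X_1,\dots,X_n$. *)

theory Defs
  imports "HOL-Probability.Probability"
begin

definition top_sum :: "nat \<Rightarrow> real list \<Rightarrow> real" where
  "top_sum l xs = sum_list (take l (rev (sort xs)))"

definition cn01_density :: "complex \<Rightarrow> ennreal" where
  "cn01_density z = ennreal (exp (- (cmod z)\<^sup>2) / pi)"

definition mu1x :: real where
  "mu1x = integral\<^sup>L (interval_measure (\<lambda>x. exp (- exp (- x)))) (\<lambda>x. x)"

end

theory Submission
  imports Defs
begin

text \<open>
  Write $G = 1 - F_X$, so that $G(x) = e^{-x} \sum_{i<L} x^i/i!$ for $x \ge 0$. The number of
  $X_i$ exceeding $x$ is binomial with parameters $n$ and $G(x)$, and $X_{i_{n-k}} > x$ if and only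
  if it is greater than $k$. The layer-cake formula gives
  \[ E[X_{i_{n-k}} - a_n] = \int_{-\infty}^{\infty} (P(X_{i_{n-k}} > a_n + t) - 1_{t<0}) \, dt . \]
  As $n G(a_n + t) \to e^{-t}$, the binomial probabilities converge to Poisson ones. The key to
  domination is that $G(x + y) \le G(x) G(y)$: together with $n G(a_n) = 1$ it bounds the integrand
  by a constant times $G(|t|)$, uniformly in $n$. In the limit, $k = 0$ gives the Gumbel mean, and
  passing from $k - 1$ to $k$ subtracts
  $\int_{-\infty}^{\infty} e^{-kt} e^{-e^{-t}} / k! \, dt = 1/k$.
\<close>

text \<open>The obstacle is that the claim concerns means: convergence in law of each order
  statistic does not by itself give convergence of expectations, so the layers need a bound that is
  uniform in \<open>n\<close> and integrable on both half-lines. On the right a union bound over the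
  \<open>n\<close> variables suffices. On the left, few exceedances must be shown unlikely when
  their expected number \<open>u\<close> is large. The crude estimate
  \<open>erlang_tail k u \<le> k / u\<close> is enough, because submultiplicativity turns
  \<open>1 / u\<close> back into a tail at \<open>- t\<close>. By linearity only the marginal law of
  each order statistic enters, never a joint limit. The scale \<open>b n\<close> is the mean excess
  of \<open>X\<close> over \<open>a n\<close>, that is, the integral of \<open>G\<close> over
  \<open>x \<ge> a n\<close> divided by \<open>G (a n)\<close>. As a quotient of polynomials in
  \<open>a n\<close> with the same leading term it tends to 1, so all estimates are made at scale 1
  and the division comes at the end. The \<open>+ 1\<close> in the limit comes from summing harmonic
  numbers.\<close>

section \<open>Erlang and binomial tails\<close>

text \<open>
  This is both the tail at $x$ of an Erlang law of shape $m$ and the probability that a Poisson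
  variable of mean $x$ is less than $m$.
\<close>

definition erlang_tail :: "nat \<Rightarrow> real \<Rightarrow> real" where
  "erlang_tail m x = exp (- x) * (\<Sum>i<m. x ^ i / fact i)"

text \<open>The sum stops before \<open>k\<close>: fewer than \<open>k\<close> successes, to match
  the Poisson reading of \<open>erlang_tail k\<close>. Indices \<open>j > n\<close> contribute 0
  through the binomial coefficient, so \<open>k\<close> may exceed \<open>n\<close>.\<close>

definition binomial_cdf :: "nat \<Rightarrow> nat \<Rightarrow> real \<Rightarrow> real" where
  "binomial_cdf n k p = (\<Sum>j<k. real (n choose j) * p ^ j * (1 - p) ^ (n - j))"

lemma erlang_tail_0 [simp]: "erlang_tail 0 x = 0"
  by (simp add: erlang_tail_def)

lemma erlang_tail_Suc: "erlang_tail (Suc m) x = erlang_tail m x + exp (- x) * x ^ m / fact m"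
  by (simp add: erlang_tail_def distrib_left)

lemma erlang_tail_at_0: "m \<ge> 1 \<Longrightarrow> erlang_tail m 0 = 1"
  by (simp add: erlang_tail_def power_0_left lessThan_Suc_atMost sum.delta if_distrib[of "\<lambda>x. x / _"] cong: if_cong)

lemma erlang_tail_nonneg: "x \<ge> 0 \<Longrightarrow> erlang_tail m x \<ge> 0"
  by (simp add: erlang_tail_def sum_nonneg)

lemma exp_le_erlang_tail: assumes "m \<ge> 1" "x \<ge> 0" shows "exp (- x) \<le> erlang_tail m x"
proof -
  have "(\<Sum>i\<in>{0}. x ^ i / fact i) \<le> (\<Sum>i<m. x ^ i / fact i)"
    using assms by (intro sum_mono2) auto
  then show ?thesis by (simp add: erlang_tail_def)
qed

lemma erlang_tail_pos: "m \<ge> 1 \<Longrightarrow> x \<ge> 0 \<Longrightarrow> erlang_tail m x > 0"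
  using exp_le_erlang_tail[of m x] exp_gt_zero[of "-x"] by linarith

text \<open>Differentiating one summand gives the difference of two neighbouring ones, so the sum
  telescopes and only the top term survives: minus the Erlang density.\<close>

lemma erlang_tail_deriv:
  "(erlang_tail (Suc m) has_real_derivative - (exp (- x) * x ^ m / fact m)) (at x)"
proof (induction m)
  case 0
  show ?case unfolding erlang_tail_def[abs_def] by (auto intro!: derivative_eq_intros)
next
  case (Suc m)
  have "((\<lambda>x. exp (- x) * x ^ Suc m) has_real_derivative
     exp (- x) * (real (Suc m) * x ^ m) - exp (- x) * x ^ Suc m) (at x)"
    by (auto intro!: derivative_eq_intros simp: algebra_simps simp del: power_Suc)
  from DERIV_add[OF Suc DERIV_cdivide[OF this, of "fact (Suc m)"]]
  have "((\<lambda>x. erlang_tail (Suc m) x + exp (- x) * x ^ Suc m / fact (Suc m)) has_real_derivative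
     - (exp (- x) * x ^ m / fact m) + (exp (- x) * (real (Suc m) * x ^ m) - exp (- x) * x ^ Suc m) / fact (Suc m)) (at x)" .
  also have "- (exp (- x) * x ^ m / fact m) + (exp (- x) * (real (Suc m) * x ^ m) - exp (- x) * x ^ Suc m) / fact (Suc m)
      = - (exp (- x) * x ^ Suc m / fact (Suc m))"
    by (simp add: diff_divide_distrib del: of_nat_Suc)
  finally show ?case by (simp add: erlang_tail_Suc[of "Suc m", abs_def])
qed

lemma erlang_tail_antimono:
  assumes "0 \<le> x" "x \<le> y" shows "erlang_tail m y \<le> erlang_tail m x"
proof (cases m)
  case (Suc k)
  have "- (exp (- z) * z ^ k / fact k) \<le> 0" if "x \<le> z" for z
    using assms that by simp
  then show ?thesis unfolding Suc
    using DERIV_nonpos_imp_nonincreasing[OF assms(2)] erlang_tail_deriv by blast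
qed auto

lemma isCont_erlang_tail: "isCont (erlang_tail m) x"
  unfolding erlang_tail_def[abs_def] by (intro continuous_intros) auto

lemma erlang_tail_strict_antimono:
  assumes "m \<ge> 1" "0 \<le> x" "x < y" shows "erlang_tail m y < erlang_tail m x"
proof -
  obtain k where k: "m = Suc k" using assms by (cases m) auto
  have cont: "continuous_on {x..y} (erlang_tail (Suc k))"
    by (intro continuous_at_imp_continuous_on ballI isCont_erlang_tail)
  have "- (exp (- z) * z ^ k / fact k) < 0" if "x < z" for z
    using assms that by simp
  then show ?thesis unfolding k
    using DERIV_neg_imp_decreasing_open[OF assms(3) _ cont] erlang_tail_deriv by blast
qed

lemma erlang_tail_le_1: "x \<ge> 0 \<Longrightarrow> erlang_tail m x \<le> 1"
  using erlang_tail_antimono[of 0 x m] erlang_tail_at_0[of m] by (cases m) auto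

lemma erlang_tail_measurable [measurable]: "erlang_tail m \<in> borel_measurable borel"
  unfolding erlang_tail_def[abs_def] by measurable

text \<open>For a Poisson process of rate 1: fewer than \<open>m\<close> points in an interval
  forces fewer than \<open>m\<close> in each of two pieces, and the pieces are independent. In the
  algebra, the binomial theorem yields a sum over the triangle \<open>i + j < m\<close>, which lies
  in the square where both indices are below \<open>m\<close>.\<close>

lemma erlang_tail_submult:
  assumes "x \<ge> 0" "y \<ge> 0"
  shows "erlang_tail m (x + y) \<le> erlang_tail m x * erlang_tail m y"
proof -
  have "(\<Sum>i<m. (x + y) ^ i / fact i) = (\<Sum>i<m. \<Sum>j\<le>i. (x ^ j / fact j) * (y ^ (i - j) / fact (i - j)))"
    by (simp add: binomial_ring binomial_fact sum_divide_distrib field_simps)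
  also have "\<dots> = (\<Sum>(i,j)\<in>{(i,j). i + j < m}. (x ^ i / fact i) * (y ^ j / fact j))"
    by (rule sum.triangle_reindex[symmetric])
  also have "\<dots> \<le> (\<Sum>(i,j)\<in>{..<m} \<times> {..<m}. (x ^ i / fact i) * (y ^ j / fact j))"
    using assms by (intro sum_mono2) auto
  also have "\<dots> = (\<Sum>i<m. x ^ i / fact i) * (\<Sum>i<m. y ^ i / fact i)"
    by (simp add: sum_product sum.cartesian_product)
  finally have "exp (- (x + y)) * (\<Sum>i<m. (x + y) ^ i / fact i)
      \<le> exp (- (x + y)) * ((\<Sum>i<m. x ^ i / fact i) * (\<Sum>i<m. y ^ i / fact i))"
    by (rule mult_left_mono) simp
  also have "\<dots> = erlang_tail m x * erlang_tail m y"
    using exp_add[of "-x" "-y"] by (simp add: erlang_tail_def mult_ac)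
  finally show ?thesis
    by (simp only: erlang_tail_def)
qed

lemma erlang_tail_abs_integrable: "integrable lborel (\<lambda>t. erlang_tail m \<bar>t\<bar>)"
proof -
  \<comment> \<open>For \<open>t \<ge> 0\<close> the tail is a sum of \<open>m\<close> Erlang
    densities of rate 1, each integrable. As \<open>g\<close> vanishes on negative arguments, adding
    its reflection covers both half-lines.\<close>
  define g where "g = (\<lambda>t::real. \<Sum>i<m. erlang_density i 1 t)"
  have "integrable lborel (erlang_density i 1)" for i
    using nn_integral_erlang_ith_moment[of 1 i 0]
    by (intro integrableI_nonneg) auto
  then have g: "integrable lborel g"
    unfolding g_def by auto
  then have g': "integrable lborel (\<lambda>t. g (0 + (-1) * t))"
    by (intro lborel_integrable_real_affine) auto
  have g_eq: "g t = erlang_tail m t" if "t \<ge> 0" for t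
    using that by (simp add: g_def erlang_tail_def erlang_density_def sum_distrib_left mult_ac)
  have nonneg: "g t \<ge> 0" for t by (simp add: g_def sum_nonneg)
  show ?thesis
  proof (rule Bochner_Integration.integrable_bound[OF Bochner_Integration.integrable_add[OF g g']])
    have "norm (erlang_tail m \<bar>t\<bar>) \<le> norm (g t + g (0 + - 1 * t))" for t
      using g_eq[of t] g_eq[of "-t"] nonneg[of t] nonneg[of "-t"] erlang_tail_nonneg[of "\<bar>t\<bar>" m]
      by (cases "t \<ge> 0") auto
    then show "AE t in lborel. norm (erlang_tail m \<bar>t\<bar>) \<le> norm (g t + g (0 + - 1 * t))" by simp
  qed (auto simp: g_def)
qed

lemma erlang_tail_tendsto_0: "(erlang_tail m \<longlongrightarrow> 0) at_top"
proof -
  have "((\<lambda>x::real. \<Sum>i<m. x ^ i / exp x / fact i) \<longlongrightarrow> (\<Sum>i<m. 0 / fact i)) at_top"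
    by (intro tendsto_intros tendsto_power_div_exp_0) auto
  then show ?thesis
    by (simp add: erlang_tail_def[abs_def] sum_distrib_left exp_minus field_simps)
qed

section \<open>Ratios of polynomials and of Erlang tails at infinity\<close>

lemma polynomial_over_leading_power_tendsto:
  fixes c :: "nat \<Rightarrow> real"
  shows "((\<lambda>x. (\<Sum>i<Suc k. c i * x ^ i) / x ^ k) \<longlongrightarrow> c k) at_top"
proof -
  have "((\<lambda>x::real. \<Sum>i<Suc k. c i * (1 / x) ^ (k - i)) \<longlongrightarrow> (\<Sum>i<Suc k. c i * 0 ^ (k - i))) at_top"
    by (intro tendsto_intros tendsto_divide_0[OF tendsto_const] filterlim_at_top_imp_at_infinity filterlim_ident)
  also have "(\<Sum>i<Suc k. c i * 0 ^ (k - i)) = c k"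
    by (simp add: power_0_left)
  finally have lim: "((\<lambda>x. \<Sum>i<Suc k. c i * (1 / x) ^ (k - i)) \<longlongrightarrow> c k) at_top" .
  show ?thesis
  proof (rule Lim_transform_eventually[OF lim])
    show "\<forall>\<^sub>F x in at_top. (\<Sum>i<Suc k. c i * (1 / x) ^ (k - i)) = (\<Sum>i<Suc k. c i * x ^ i) / x ^ k"
      using eventually_gt_at_top[of 0]
    proof eventually_elim
      case (elim x)
      have "(1 / x) ^ (k - i) = x ^ i / x ^ k" if "i < Suc k" for i
        using elim that by (simp add: power_diff power_divide)
      then show ?case by (simp add: sum_divide_distrib del: sum.lessThan_Suc)
    qed
  qed
qed

lemma polynomial_ratio_tendsto_1:
  fixes c d :: "nat \<Rightarrow> real"
  assumes "c k = d k" "d k \<noteq> 0"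
  shows "((\<lambda>x. (\<Sum>i<Suc k. c i * x ^ i) / (\<Sum>i<Suc k. d i * x ^ i)) \<longlongrightarrow> 1) at_top"
proof -
  have "((\<lambda>x. ((\<Sum>i<Suc k. c i * x ^ i) / x ^ k) / ((\<Sum>i<Suc k. d i * x ^ i) / x ^ k)) \<longlongrightarrow> c k / d k) at_top"
    using assms by (intro tendsto_divide polynomial_over_leading_power_tendsto)
  then have "((\<lambda>x. ((\<Sum>i<Suc k. c i * x ^ i) / x ^ k) / ((\<Sum>i<Suc k. d i * x ^ i) / x ^ k)) \<longlongrightarrow> 1) at_top"
    using assms by simp
  then show ?thesis
  proof (rule Lim_transform_eventually)
    show "\<forall>\<^sub>F x in at_top. ((\<Sum>i<Suc k. c i * x ^ i) / x ^ k) / ((\<Sum>i<Suc k. d i * x ^ i) / x ^ k)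
        = (\<Sum>i<Suc k. c i * x ^ i) / (\<Sum>i<Suc k. d i * x ^ i)"
      using eventually_gt_at_top[of 0] by eventually_elim simp
  qed
qed

text \<open>The exponential factors give \<open>exp (- t)\<close> exactly, and a shift of the
  argument does not affect the leading growth of the polynomial factor. This is the Gumbel domain of
  attraction with scale 1.\<close>

lemma erlang_tail_ratio_tendsto:
  assumes "m \<ge> 1"
  shows "((\<lambda>x. erlang_tail m (x + t) / erlang_tail m x) \<longlongrightarrow> exp (- t)) at_top"
proof -
  obtain k where m: "m = Suc k" using assms by (cases m) auto
  define P where "P = (\<lambda>x::real. \<Sum>i<m. x ^ i / fact i)"
  have P: "((\<lambda>x. P x / x ^ k) \<longlongrightarrow> 1 / fact k) at_top"
    using polynomial_over_leading_power_tendsto[of "\<lambda>i. 1 / fact i" k] by (simp add: P_def m)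
  have shift: "filterlim (\<lambda>x. x + t) at_top at_top"
    using filterlim_tendsto_add_at_top[OF tendsto_const[of t] filterlim_ident] by (simp add: add.commute)
  have "((\<lambda>x::real. 1 + t / x) \<longlongrightarrow> 1 + 0) at_top"
    by (intro tendsto_intros tendsto_divide_0[OF tendsto_const] filterlim_at_top_imp_at_infinity filterlim_ident)
  then have 1: "((\<lambda>x. (1 + t / x) ^ k) \<longlongrightarrow> 1 ^ k) at_top" by (intro tendsto_power) simp
  have "((\<lambda>x. exp (- t) * ((P (x + t) / (x + t) ^ k) * (1 + t / x) ^ k / (P x / x ^ k)))
     \<longlongrightarrow> exp (- t) * ((1 / fact k) * 1 ^ k / (1 / fact k))) at_top"
    by (intro tendsto_intros P 1 filterlim_compose[OF P shift]) auto
  then have "((\<lambda>x. exp (- t) * ((P (x + t) / (x + t) ^ k) * (1 + t / x) ^ k / (P x / x ^ k)))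
     \<longlongrightarrow> exp (- t)) at_top" by simp
  then show ?thesis
  proof (rule Lim_transform_eventually)
    show "\<forall>\<^sub>F x in at_top. exp (- t) * ((P (x + t) / (x + t) ^ k) * (1 + t / x) ^ k / (P x / x ^ k))
        = erlang_tail m (x + t) / erlang_tail m x"
      using eventually_gt_at_top[of 0] eventually_gt_at_top[of "-t"]
    proof eventually_elim
      case (elim x)
      then have "1 + t / x = (x + t) / x" by (simp add: field_simps)
      then show ?case
        using elim exp_add[of "-x" "-t"] by (simp add: erlang_tail_def P_def power_divide)
    qed
  qed
qed

text \<open>Markov's inequality for the Erlang law of shape \<open>k\<close>, whose mean is
  \<open>k\<close>. Termwise, multiplying by \<open>u\<close> raises the degree at the cost of a
  factor \<open>Suc j \<le> k\<close>, which leaves the tail of the next shape, at most 1.\<close>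

lemma erlang_tail_le_inverse:
  assumes "u > 0" shows "erlang_tail k u \<le> real k / u"
proof -
  have "u * erlang_tail k u = exp (- u) * (\<Sum>j<k. u * (u ^ j / fact j))"
    by (simp add: erlang_tail_def sum_distrib_left mult_ac)
  also have "(\<Sum>j<k. u * (u ^ j / fact j)) \<le> (\<Sum>j<k. real k * (u ^ Suc j / fact (Suc j)))"
  proof (rule sum_mono)
    fix j assume "j \<in> {..<k}"
    then have "real (Suc j) \<le> real k" by auto
    then have "real (Suc j) * (u ^ Suc j / fact (Suc j)) \<le> real k * (u ^ Suc j / fact (Suc j))"
      using assms by (intro mult_right_mono) auto
    then show "u * (u ^ j / fact j) \<le> real k * (u ^ Suc j / fact (Suc j))"
      by (simp del: of_nat_Suc)
  qed
  also have "\<dots> \<le> real k * (\<Sum>j<Suc k. u ^ j / fact j)"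
    unfolding sum.lessThan_Suc_shift sum_distrib_left[symmetric] by (intro mult_left_mono) auto
  finally have "u * erlang_tail k u \<le> real k * erlang_tail (Suc k) u"
    by (simp add: erlang_tail_def mult_left_mono mult.left_commute)
  also have "\<dots> \<le> real k"
    using erlang_tail_le_1[of u "Suc k"] assms by (intro mult_left_le) auto
  finally show ?thesis using assms by (simp add: field_simps)
qed

section \<open>Binomial distribution functions: uniform bounds and the Poisson limit\<close>

lemma binomial_cdf_le_1: assumes "0 \<le> p" "p \<le> 1" shows "binomial_cdf n k p \<le> 1"
proof -
  have "binomial_cdf n k p = (\<Sum>j\<in>{..<k}\<inter>{..n}. real (n choose j) * p ^ j * (1 - p) ^ (n - j))"
    unfolding binomial_cdf_def by (rule sum.mono_neutral_right) auto
  also have "\<dots> \<le> (\<Sum>j\<le>n. real (n choose j) * p ^ j * (1 - p) ^ (n - j))"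
    using assms by (intro sum_mono2) auto
  also have "\<dots> = 1" using binomial_ring[of p "1 - p" n] by simp
  finally show ?thesis .
qed

lemma binomial_cdf_nonneg: "0 \<le> p \<Longrightarrow> p \<le> 1 \<Longrightarrow> 0 \<le> binomial_cdf n k p"
  unfolding binomial_cdf_def by (intro sum_nonneg) auto

lemma binomial_cdf_at_1: "k \<le> n \<Longrightarrow> binomial_cdf n k 1 = 0"
  unfolding binomial_cdf_def by (intro sum.neutral) (auto simp: power_0_left)

text \<open>The union bound for at least one success, obtained from Bernoulli's inequality for the
  term \<open>j = 0\<close>.\<close>

lemma binomial_cdf_ge:
  assumes "0 \<le> p" "p \<le> 1" "k \<ge> 1"
  shows "1 - real n * p \<le> binomial_cdf n k p"
proof -
  have "1 - real n * p \<le> (1 - p) ^ n"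
    using Bernoulli_inequality[of "-p" n] assms by simp
  also have "\<dots> = (\<Sum>j\<in>{0}. real (n choose j) * p ^ j * (1 - p) ^ (n - j))" by simp
  also have "\<dots> \<le> binomial_cdf n k p"
    unfolding binomial_cdf_def using assms by (intro sum_mono2) auto
  finally show ?thesis .
qed

text \<open>A Poisson comparison valid for every \<open>n\<close>, not only in the limit. The factor
  \<open>exp k\<close> pays for the \<open>j\<close> missing failures:
  \<open>(1 - p) ^ (n - j)\<close> is at most \<open>exp (- n p) * exp (j p)\<close>, and
  \<open>j p \<le> k\<close>.\<close>

lemma binomial_cdf_le_erlang_tail:
  assumes "0 \<le> p" "p \<le> 1"
  shows "binomial_cdf n k p \<le> exp (real k) * erlang_tail k (real n * p)"
proof -
  have "real (n choose j) * p ^ j * (1 - p) ^ (n - j) \<le>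
      exp (real k) * (exp (- (real n * p)) * ((real n * p) ^ j / fact j))" if "j < k" for j
  proof (cases "j \<le> n")
    case True
    have "real (n choose j) * fact j \<le> real n ^ j"
      using binomial_fact_pow[of n j] by (metis of_nat_fact of_nat_le_iff of_nat_mult of_nat_power)
    then have "(real (n choose j) * fact j) * p ^ j \<le> real n ^ j * p ^ j"
      using assms by (intro mult_right_mono) auto
    then have 1: "real (n choose j) * p ^ j \<le> (real n * p) ^ j / fact j"
      by (simp add: power_mult_distrib pos_le_divide_eq mult_ac)
    have "(1 - p) ^ (n - j) \<le> exp (- p) ^ (n - j)"
      using assms exp_ge_add_one_self[of "-p"] by (intro power_mono) auto
    also have "\<dots> = exp (real (n - j) * - p)"
      by (rule exp_of_nat_mult[symmetric])
    also have "real (n - j) * - p = real j * p - real n * p"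
      using True by (simp add: of_nat_diff algebra_simps)
    also have "real j * p \<le> real k * 1"
      using assms that by (intro mult_mono) auto
    then have "exp (real j * p - real n * p) \<le> exp (real k - real n * p)" by simp
    finally have 2: "(1 - p) ^ (n - j) \<le> exp (real k) * exp (- (real n * p))"
      by (simp add: exp_add[symmetric])
    show ?thesis
      using mult_mono[OF 1 2] assms by (simp add: mult_ac)
  next
    case False
    then have "n choose j = 0" by simp
    then show ?thesis using assms by (simp del: binomial_eq_0_iff)
  qed
  then show ?thesis
    unfolding binomial_cdf_def erlang_tail_def sum_distrib_left by (intro sum_mono) auto
qed

lemma binomial_cdf_tendsto:
  assumes "(\<lambda>n. real n * p n) \<longlonglongrightarrow> u"
  shows "(\<lambda>n. binomial_cdf n k (p n)) \<longlonglongrightarrow> erlang_tail k u"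
proof -
  have "(\<lambda>n. (real n * p n) * (1 / real n)) \<longlonglongrightarrow> u * 0"
    by (intro tendsto_mult assms lim_1_over_n)
  then have "(\<lambda>n. (real n * p n) * (1 / real n)) \<longlonglongrightarrow> 0" by simp
  then have p: "p \<longlonglongrightarrow> 0"
  proof (rule Lim_transform_eventually)
    show "\<forall>\<^sub>F n in sequentially. (real n * p n) * (1 / real n) = p n"
      using eventually_gt_at_top[of 0] by eventually_elim simp
  qed
  have e: "(\<lambda>n. (1 - p n) ^ n) \<longlonglongrightarrow> exp (- u)"
  proof -
    have small: "\<forall>\<^sub>F n in sequentially. p n < 1"
      using p by (rule order_tendstoD) auto
    \<comment> \<open>Some \<open>p n\<close> may be 0, so the quotient
      \<open>ln (1 - x) / x\<close> is extended continuously by its limit -1 before it is composed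
      with \<open>p\<close>.\<close>
    have l: "((\<lambda>x::real. if x = 0 then - 1 else ln (1 - x) / x) \<longlongrightarrow> - 1) (at 0)"
    proof -
      have "((\<lambda>x::real. ln (1 - x)) has_real_derivative - 1) (at 0)"
        by (auto intro!: derivative_eq_intros)
      then have "((\<lambda>x::real. ln (1 - x) / x) \<longlongrightarrow> - 1) (at 0)"
        by (simp add: has_field_derivative_iff)
      then show ?thesis by (rule Lim_transform_eventually) (auto simp: eventually_at_filter)
    qed
    then have "isCont (\<lambda>x::real. if x = 0 then - 1 else ln (1 - x) / x) 0"
      by (simp add: isCont_def)
    from isCont_tendsto_compose[OF this p]
    have "(\<lambda>n. real n * p n * (if p n = 0 then - 1 else ln (1 - p n) / p n)) \<longlonglongrightarrow> u * - 1"
      using assms by (intro tendsto_mult) auto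
    then have "(\<lambda>n. exp (real n * p n * (if p n = 0 then - 1 else ln (1 - p n) / p n))) \<longlonglongrightarrow> exp (- u)"
      by (intro tendsto_exp) auto
    then show ?thesis
    proof (rule Lim_transform_eventually)
      show "\<forall>\<^sub>F n in sequentially.
          exp (real n * p n * (if p n = 0 then - 1 else ln (1 - p n) / p n)) = (1 - p n) ^ n"
        using small
      proof eventually_elim
        case (elim n)
        then have "exp (real n * ln (1 - p n)) = (1 - p n) ^ n"
          by (simp add: exp_of_nat_mult)
        then show ?case by simp
      qed
    qed
  qed
  have "(\<lambda>n. real (n choose j) * p n ^ j * (1 - p n) ^ (n - j)) \<longlonglongrightarrow> exp (- u) * (u ^ j / fact j)" for j
  proof -
    \<comment> \<open>The falling factorial of \<open>n\<close> with \<open>j\<close> factors is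
      asymptotic to \<open>n ^ j\<close>; this turns binomial coefficients into Poisson
      weights.\<close>
    have "(\<lambda>n. real (n choose j) * fact j / real n ^ j) \<longlonglongrightarrow> 1"
    proof -
      have "(\<lambda>n. (\<Prod>i<j. (1 - real i * (1 / real n)))) \<longlonglongrightarrow> (\<Prod>i<j. 1 - real i * 0)"
        by (intro tendsto_intros lim_1_over_n)
      then have "(\<lambda>n. (\<Prod>i<j. (1 - real i * (1 / real n)))) \<longlonglongrightarrow> 1" by simp
      then show ?thesis
      proof (rule Lim_transform_eventually)
        show "\<forall>\<^sub>F n in sequentially. (\<Prod>i<j. 1 - real i * (1 / real n)) = real (n choose j) * fact j / real n ^ j"
          using eventually_gt_at_top[of 0]
        proof eventually_elim
          case (elim n)
          have "real (n choose j) * fact j = (\<Prod>i<j. real n - real i)"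
            by (simp add: binomial_gbinomial gbinomial_mult_fact' atLeast0LessThan)
          also have "\<dots> / real n ^ j = (\<Prod>i<j. (real n - real i) / real n)"
            by (simp add: prod_dividef)
          also have "\<dots> = (\<Prod>i<j. 1 - real i * (1 / real n))"
            using elim by (intro prod.cong) (auto simp: field_simps)
          finally show ?case by simp
        qed
      qed
    qed
    then have "(\<lambda>n. (real (n choose j) * fact j / real n ^ j) * (real n * p n) ^ j * (1 - p n) ^ n
        / (1 - p n) ^ j / fact j) \<longlonglongrightarrow> 1 * u ^ j * exp (- u) / (1 - 0) ^ j / fact j"
      by (intro tendsto_intros assms e p) auto
    then have "(\<lambda>n. (real (n choose j) * fact j / real n ^ j) * (real n * p n) ^ j * (1 - p n) ^ n
        / (1 - p n) ^ j / fact j) \<longlonglongrightarrow> exp (- u) * (u ^ j / fact j)"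
      by (simp add: mult_ac)
    then show ?thesis
    proof (rule Lim_transform_eventually)
      show "\<forall>\<^sub>F n in sequentially. (real (n choose j) * fact j / real n ^ j) * (real n * p n) ^ j * (1 - p n) ^ n
        / (1 - p n) ^ j / fact j = real (n choose j) * p n ^ j * (1 - p n) ^ (n - j)"
        using eventually_gt_at_top[of 0] eventually_ge_at_top[of j] order_tendstoD(2)[OF p, of 1, simplified]
        by eventually_elim (simp add: power_diff power_mult_distrib)
    qed
  qed
  then show ?thesis
    unfolding binomial_cdf_def erlang_tail_def sum_distrib_left by (intro tendsto_sum)
qed

section \<open>Layer-cake representation and the Gumbel limit\<close>

text \<open>The layer-cake integrand of the limit law of the rescaled $k$-th largest value.\<close>

definition gumbel_layer :: "nat \<Rightarrow> real \<Rightarrow> real" where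
  "gumbel_layer k t = 1 - erlang_tail k (exp (- t)) - indicator {..<0} t"

text \<open>The integrand is the indicator of \<open>{0..<y}\<close> if \<open>y \<ge> 0\<close> and
  minus that of \<open>{y..<0}\<close> otherwise. Subtracting the fixed indicator is what admits
  variables of either sign.\<close>

lemma has_bochner_integral_layer:
  "has_bochner_integral lborel (\<lambda>t. indicator {..<y} t - indicator {..<0} t :: real) y"
proof (cases "y \<ge> 0")
  case True
  have "has_bochner_integral lborel (indicator {0..<y} :: real \<Rightarrow> real) (measure lborel {0..<y})"
    using True by (intro has_bochner_integral_real_indicator) auto
  moreover have "(indicator {0..<y} :: real \<Rightarrow> real) = (\<lambda>t. indicator {..<y} t - indicator {..<0} t)"
    using True by (auto simp: fun_eq_iff indicator_def)
  ultimately show ?thesis using True by simp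
next
  case False
  have "has_bochner_integral lborel (\<lambda>t. - (indicator {y..<0} t :: real)) (- measure lborel {y..<0})"
    using False by (intro has_bochner_integral_minus has_bochner_integral_real_indicator) auto
  moreover have "(\<lambda>t. - (indicator {y..<0} t :: real)) = (\<lambda>t. indicator {..<y} t - indicator {..<0} t)"
    using False by (auto simp: fun_eq_iff indicator_def)
  ultimately show ?thesis using False by simp
qed

text \<open>Fubini applied to the preceding identity at \<open>y = Y \<omega>\<close>. Integrability
  is required of the layers alone; that of \<open>Y\<close> is a conclusion, so moments of order
  statistics need no separate estimate.\<close>

lemma (in prob_space) layer_cake:
  assumes Y [measurable]: "random_variable borel Y"
    and int: "integrable lborel (\<lambda>t. prob {\<omega> \<in> space M. t < Y \<omega>} - indicator {..<0} t)"
  shows "integrable M Y"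
    and "expectation Y = (\<integral>t. prob {\<omega> \<in> space M. t < Y \<omega>} - indicator {..<0} t \<partial>lborel)"
proof -
  interpret P: pair_sigma_finite lborel M ..
  define f :: "real \<Rightarrow> 'a \<Rightarrow> real"
    where "f = (\<lambda>t \<omega>. (if t < Y \<omega> then 1 else 0) - indicator {..<0} t)"
  have f_meas [measurable]: "case_prod f \<in> borel_measurable (lborel \<Otimes>\<^sub>M M)"
    unfolding f_def by measurable
  have ind: "f t \<omega> = indicator {\<omega> \<in> space M. t < Y \<omega>} \<omega> - indicator {..<0} t" if "\<omega> \<in> space M" for t \<omega>
    using that by (auto simp: f_def indicator_def)
  have f_int: "integrable M (f t)" for t
    by (rule integrable_const_bound[of _ 1]) (auto simp: f_def indicator_def)
  have f_eq: "(\<integral>\<omega>. f t \<omega> \<partial>M) = prob {\<omega> \<in> space M. t < Y \<omega>} - indicator {..<0} t" for t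
  proof -
    have "(\<integral>\<omega>. f t \<omega> \<partial>M) = (\<integral>\<omega>. indicator {\<omega> \<in> space M. t < Y \<omega>} \<omega> - indicator {..<0} t \<partial>M)"
      by (intro Bochner_Integration.integral_cong refl ind)
    also have "\<dots> = prob {\<omega> \<in> space M. t < Y \<omega>} - indicator {..<0} t"
      by (subst Bochner_Integration.integral_diff) (auto simp: prob_space less_top[symmetric])
    finally show ?thesis .
  qed
  \<comment> \<open>For fixed \<open>t\<close> the sign of \<open>f t \<omega>\<close> does not depend on \<open>\<omega>\<close>.\<close>
  have norm_eq: "(\<integral>\<omega>. norm (f t \<omega>) \<partial>M) = norm (prob {\<omega> \<in> space M. t < Y \<omega>} - indicator {..<0} t)" for t
  proof (cases "t < 0")
    case True
    then have "(\<integral>\<omega>. norm (f t \<omega>) \<partial>M) = (\<integral>\<omega>. - f t \<omega> \<partial>M)"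
      by (intro Bochner_Integration.integral_cong) (auto simp: f_def)
    then show ?thesis using True f_eq[of t] prob_le_1[of "{\<omega> \<in> space M. t < Y \<omega>}"] by simp
  next
    case False
    then have "(\<integral>\<omega>. norm (f t \<omega>) \<partial>M) = (\<integral>\<omega>. f t \<omega> \<partial>M)"
      by (intro Bochner_Integration.integral_cong) (auto simp: f_def)
    then show ?thesis using False f_eq[of t] by simp
  qed
  have "integrable (lborel \<Otimes>\<^sub>M M) (case_prod f)"
  proof (rule P.Fubini_integrable)
    show "integrable lborel (\<lambda>t. \<integral>\<omega>. norm (case_prod f (t, \<omega>)) \<partial>M)"
      using Bochner_Integration.integrable_norm[OF int] by (simp only: prod.case norm_eq)
  qed (auto simp: f_int f_meas)
  note F = this P.integrable_snd[OF this] P.Fubini_integral[OF this]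
  have "(\<integral>t. f t \<omega> \<partial>lborel) = Y \<omega>" for \<omega>
  proof -
    have "f t \<omega> = indicator {..<Y \<omega>} t - indicator {..<0} t" for t
      by (simp add: f_def indicator_def)
    then show ?thesis
      using has_bochner_integral_integral_eq[OF has_bochner_integral_layer[of "Y \<omega>"]] by simp
  qed
  with F(2,3) show "integrable M Y"
    "expectation Y = (\<integral>t. prob {\<omega> \<in> space M. t < Y \<omega>} - indicator {..<0} t \<partial>lborel)"
    by (simp_all only: f_eq)
qed

text \<open>With \<open>s = exp (- t)\<close>, the bound \<open>exp (- s) \<le> 1 / s\<close>
  handles \<open>t < 0\<close> and \<open>1 - exp (- s) \<le> s\<close> handles
  \<open>t \<ge> 0\<close>; both give \<open>exp (- \<bar>t\<bar>)\<close>.\<close>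

lemma gumbel_layer_1_integrable: "integrable lborel (gumbel_layer 1)"
proof (rule Bochner_Integration.integrable_bound[OF erlang_tail_abs_integrable[of 1]])
  have "norm (gumbel_layer 1 t) \<le> norm (erlang_tail 1 \<bar>t\<bar>)" for t
  proof (cases "t < 0")
    case True
    have "erlang_tail 1 (exp (- t)) \<le> 1 / exp (- t)"
      using erlang_tail_le_inverse[of "exp (-t)" 1] by simp
    then show ?thesis using True erlang_tail_nonneg[of "exp (-t)" 1]
      by (simp add: gumbel_layer_def erlang_tail_def exp_minus field_simps)
  next
    case False
    have "1 - exp (- t) \<le> exp (- exp (- t))"
      using exp_ge_add_one_self[of "- exp (- t)"] by simp
    then show ?thesis using False by (simp add: gumbel_layer_def erlang_tail_def)
  qed
  then show "AE t in lborel. norm (gumbel_layer 1 t) \<le> norm (erlang_tail 1 \<bar>t\<bar>)" by simp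
qed (simp add: gumbel_layer_def[abs_def])

text \<open>The difference is a single Poisson weight, equal to \<open>1 / Suc m\<close> times the
  derivative \<open>g\<close> of the limiting distribution function \<open>Q\<close>. As
  \<open>Q\<close> increases from 0 to 1, \<open>g\<close> has integral 1.\<close>

lemma gumbel_layer_step:
  "has_bochner_integral lborel (\<lambda>t. gumbel_layer (Suc m) t - gumbel_layer (Suc (Suc m)) t) (1 / real (Suc m))"
proof -
  define g where "g = (\<lambda>t::real. exp (- exp (- t)) * exp (- t) ^ Suc m / fact m)"
  define Q where "Q = (\<lambda>t. erlang_tail (Suc m) (exp (- t)))"
  have deriv: "(Q has_real_derivative g t) (at t)" for t
  proof -
    have "((\<lambda>t. exp (- t)) has_real_derivative - exp (- t)) (at t)"
      by (auto intro!: derivative_eq_intros)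
    from DERIV_chain2[OF erlang_tail_deriv this] show ?thesis
      unfolding Q_def g_def by (simp add: mult_ac)
  qed
  have bot: "(Q \<longlongrightarrow> 0) at_bot" and top: "(Q \<longlongrightarrow> 1) at_top"
  proof -
    have "filterlim (\<lambda>t::real. exp (- t)) at_top at_bot"
      by (intro filterlim_compose[OF exp_at_top] filterlim_uminus_at_top_at_bot)
    then show "(Q \<longlongrightarrow> 0) at_bot"
      unfolding Q_def by (rule filterlim_compose[OF erlang_tail_tendsto_0])
    have "((\<lambda>t::real. exp (- t)) \<longlongrightarrow> 0) at_top"
      by (intro filterlim_compose[OF exp_at_bot] filterlim_uminus_at_bot_at_top)
    then have "(Q \<longlongrightarrow> erlang_tail (Suc m) 0) at_top"
      unfolding Q_def by (rule isCont_tendsto_compose[OF isCont_erlang_tail])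
    then show "(Q \<longlongrightarrow> 1) at_top" by (simp add: erlang_tail_at_0)
  qed
  have cont: "isCont g t" for t unfolding g_def by (intro continuous_intros) auto
  have lims: "((Q \<circ> real_of_ereal) \<longlongrightarrow> 0) (at_right (-\<infinity>))" "((Q \<circ> real_of_ereal) \<longlongrightarrow> 1) (at_left \<infinity>)"
    using bot top by (simp_all add: ereal_tendsto_simps)
  have nonneg: "AE x in lborel. - \<infinity> < ereal x \<longrightarrow> ereal x < \<infinity> \<longrightarrow> 0 \<le> g x"
    by (simp add: g_def)
  have "set_integrable lborel (einterval (-\<infinity>) \<infinity>) g" "(LBINT x=-\<infinity>..\<infinity>. g x) = 1 - 0"
    using interval_integral_FTC_nonneg[OF _ deriv cont nonneg lims] by simp_all
  then have "has_bochner_integral lborel g 1"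
    by (simp add: interval_lebesgue_integral_def set_integrable_def set_lebesgue_integral_def
        has_bochner_integral_iff)
  then have "has_bochner_integral lborel (\<lambda>t. g t / real (Suc m)) (1 / real (Suc m))"
    by (rule has_bochner_integral_divide_zero)
  moreover have "(\<lambda>t. g t / real (Suc m)) = (\<lambda>t. gumbel_layer (Suc m) t - gumbel_layer (Suc (Suc m)) t)"
    by (simp add: gumbel_layer_def fun_eq_iff erlang_tail_Suc[of "Suc m"] g_def del: of_nat_Suc)
  ultimately show ?thesis by simp
qed

text \<open>The layer-cake formula for the identity function under the Gumbel law, whose tail is
  \<open>1 - exp (- exp (- t))\<close>.\<close>

lemma mu1x_eq: "mu1x = integral\<^sup>L lborel (gumbel_layer 1)"
proof -
  define F where "F = (\<lambda>x::real. exp (- exp (- x)))"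
  have mono: "F x \<le> F y" if "x \<le> y" for x y
    using that by (simp add: F_def)
  have cont: "continuous (at_right x) F" for x
    unfolding F_def by (intro continuous_intros)
  have bot: "(F \<longlongrightarrow> 0) at_bot"
    unfolding F_def
    by (intro filterlim_compose[OF exp_at_bot] filterlim_compose[OF filterlim_uminus_at_bot_at_top]
        filterlim_compose[OF exp_at_top] filterlim_uminus_at_top_at_bot)
  have top: "(F \<longlongrightarrow> 1) at_top"
  proof -
    have "((\<lambda>t::real. exp (- t)) \<longlongrightarrow> 0) at_top"
      by (intro filterlim_compose[OF exp_at_bot] filterlim_uminus_at_bot_at_top)
    then have "(F \<longlongrightarrow> exp (- 0)) at_top"
      unfolding F_def by (intro tendsto_intros)
    then show ?thesis by simp
  qed
  interpret D: real_distribution "interval_measure F"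
    by (rule real_distribution_interval_measure[OF mono cont bot top])
  have "D.prob {\<omega> \<in> space (interval_measure F). t < \<omega>} - indicator {..<0} t = gumbel_layer 1 t" for t
  proof -
    have "{\<omega> \<in> space (interval_measure F). t < \<omega>} = space (interval_measure F) - {..t}"
      by auto
    then have "D.prob {\<omega> \<in> space (interval_measure F). t < \<omega>} = 1 - F t"
      using D.prob_compl[of "{..t}"] measure_interval_measure_Iic[OF mono cont bot] by simp
    then show ?thesis by (simp add: gumbel_layer_def erlang_tail_def F_def)
  qed
  with D.layer_cake(2)[of "\<lambda>x. x"] gumbel_layer_1_integrable
  show ?thesis by (simp add: mu1x_def F_def[symmetric])
qed

lemma gumbel_layer_integral:
  "has_bochner_integral lborel (gumbel_layer (Suc m)) (mu1x - (\<Sum>i=1..m. 1 / real i))"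
proof (induction m)
  case 0
  show ?case using gumbel_layer_1_integrable by (simp add: has_bochner_integral_iff mu1x_eq)
next
  case (Suc m)
  show ?case
    using has_bochner_integral_diff[OF Suc gumbel_layer_step[of m]] by (simp add: algebra_simps)
qed

text \<open>The dominating function for the limit in \<open>n\<close>: its right side is free of
  \<open>n\<close> and \<open>a\<close>. The constant adds the two one-sided constants, 1 for
  \<open>t \<ge> 0\<close> and \<open>exp k * k\<close> for \<open>- a \<le> t < 0\<close>.\<close>

lemma rescaled_binomial_layer_bound:
  assumes m: "m \<ge> 1" and k: "1 \<le> k" "k \<le> n" and a: "a \<ge> 0" "erlang_tail m a = 1 / real n"
    and G: "G = (\<lambda>x. if x < 0 then 1 else erlang_tail m x)"
  shows "\<bar>1 - binomial_cdf n k (G (a + t)) - indicator {..<0} t\<bar>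
    \<le> (1 + exp (real k) * real k) * erlang_tail m \<bar>t\<bar>"
proof -
  have n: "n > 0" using k by simp
  have G01: "0 \<le> G x" "G x \<le> 1" for x
    using erlang_tail_nonneg erlang_tail_le_1 by (auto simp: G)
  consider "t \<ge> 0" | "t < - a" | "- a \<le> t" "t < 0" by linarith
  then show ?thesis
  proof cases
    case 1
    have "1 - binomial_cdf n k (G (a + t)) \<le> real n * G (a + t)"
      using binomial_cdf_ge[OF G01[of "a + t"] k(1), of n] by simp
    also have "\<dots> = real n * erlang_tail m (a + t)" using 1 a by (simp add: G)
    also have "\<dots> \<le> real n * (erlang_tail m a * erlang_tail m t)"
      using erlang_tail_submult[of a t m] 1 a by (intro mult_left_mono) auto
    also have "\<dots> = erlang_tail m t" using a n by simp
    also have "\<dots> \<le> (1 + exp (real k) * real k) * erlang_tail m t"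
      using erlang_tail_nonneg[OF 1, of m] by (simp add: algebra_simps)
    finally show ?thesis using 1 binomial_cdf_le_1[OF G01[of "a + t"], of n k] by simp
  next
    \<comment> \<open>Below 0 every variable exceeds the level, so, as \<open>k \<le> n\<close>, the
      layer vanishes.\<close>
    case 2
    then have "G (a + t) = 1" by (simp add: G)
    then show ?thesis using 2 a k by (simp add: binomial_cdf_at_1 erlang_tail_nonneg)
  next
    case 3
    define u where "u = real n * erlang_tail m (a + t)"
    \<comment> \<open>Submultiplicativity for the splitting \<open>a = (a + t) + (- t)\<close> now
      bounds the expected count \<open>u\<close> from below.\<close>
    have "1 / real n \<le> erlang_tail m (a + t) * erlang_tail m (- t)"
      using erlang_tail_submult[of "a + t" "- t" m] 3 a by simp
    then have *: "1 \<le> u * erlang_tail m (- t)"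
      using n by (simp add: u_def field_simps)
    have u: "u > 0" unfolding u_def using 3 n erlang_tail_pos[OF m, of "a + t"] by simp
    have "binomial_cdf n k (G (a + t)) \<le> exp (real k) * erlang_tail k u"
      using binomial_cdf_le_erlang_tail[OF G01[of "a + t"], of n k] 3 by (simp add: G u_def)
    also have "\<dots> \<le> exp (real k) * (real k / u)"
      using erlang_tail_le_inverse[OF u] by (intro mult_left_mono) auto
    also have "1 / u \<le> erlang_tail m (- t)"
      using * u by (simp add: field_simps)
    then have "exp (real k) * (real k / u) \<le> exp (real k) * real k * erlang_tail m (- t)"
      by (simp add: divide_inverse mult.assoc mult_left_mono)
    also have "\<dots> \<le> (1 + exp (real k) * real k) * erlang_tail m (- t)"
      using erlang_tail_nonneg[of "-t" m] 3 by (simp add: algebra_simps)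
    finally show ?thesis using 3 binomial_cdf_nonneg[OF G01[of "a + t"], of n k] by simp
  qed
qed

lemma rescaled_binomial_layer_tendsto:
  assumes m: "m \<ge> 1" and a: "\<forall>\<^sub>F n in sequentially. erlang_tail m (a n) = 1 / real n"
    and lim: "filterlim a at_top sequentially"
    and G: "G = (\<lambda>x. if x < 0 then 1 else erlang_tail m x)"
  shows "(\<lambda>n. 1 - binomial_cdf n k (G (a n + t)) - indicator {..<0} t) \<longlonglongrightarrow> gumbel_layer k t"
proof -
  have "(\<lambda>n. erlang_tail m (a n + t) / erlang_tail m (a n)) \<longlonglongrightarrow> exp (- t)"
    by (rule filterlim_compose[OF erlang_tail_ratio_tendsto[OF m] lim])
  then have "(\<lambda>n. real n * G (a n + t)) \<longlonglongrightarrow> exp (- t)"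
  proof (rule Lim_transform_eventually)
    have "\<forall>\<^sub>F n in sequentially. - t \<le> a n"
      using lim by (simp add: filterlim_at_top)
    with a show "\<forall>\<^sub>F n in sequentially. erlang_tail m (a n + t) / erlang_tail m (a n) = real n * G (a n + t)"
      by eventually_elim (simp add: G)
  qed
  then show ?thesis
    unfolding gumbel_layer_def by (intro tendsto_intros binomial_cdf_tendsto)
qed

lemma rescaled_binomial_layer_integral:
  assumes m: "m \<ge> 1" and k: "k \<ge> 1"
    and a: "\<forall>\<^sub>F n in sequentially. erlang_tail m (a n) = 1 / real n"
    and lim: "filterlim a at_top sequentially"
    and G: "G = (\<lambda>x. if x < 0 then 1 else erlang_tail m x)"
  defines "D \<equiv> \<lambda>n t. 1 - binomial_cdf n k (G (a n + t)) - indicator {..<0} t"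
  shows "\<forall>\<^sub>F n in sequentially. integrable lborel (D n)"
    and "(\<lambda>n. integral\<^sup>L lborel (D n)) \<longlonglongrightarrow> integral\<^sup>L lborel (gumbel_layer k)"
proof -
  have "\<forall>\<^sub>F n in sequentially. 0 \<le> a n"
    using lim by (simp add: filterlim_at_top)
  with a eventually_ge_at_top[of k]
  have "\<forall>\<^sub>F n in sequentially. 0 \<le> a n \<and> erlang_tail m (a n) = 1 / real n \<and> k \<le> n"
    by eventually_elim auto
  then obtain N where N: "\<And>n. n \<ge> N \<Longrightarrow> 0 \<le> a n \<and> erlang_tail m (a n) = 1 / real n \<and> k \<le> n"
    by (auto simp: eventually_sequentially)
  have [measurable]: "G \<in> borel_measurable borel" unfolding G by measurable
  have meas: "gumbel_layer k \<in> borel_measurable lborel" "D n \<in> borel_measurable lborel" for n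
    unfolding gumbel_layer_def[abs_def] D_def binomial_cdf_def by measurable
  have w: "integrable lborel (\<lambda>t. (1 + exp (real k) * real k) * erlang_tail m \<bar>t\<bar>)"
    by (intro integrable_mult_right erlang_tail_abs_integrable)
  \<comment> \<open>The bound holds only once \<open>a n\<close> is a nonnegative exact quantile and
    \<open>k \<le> n\<close>, whereas dominated convergence asks for it at every index; hence the
    shift by \<open>N\<close>.\<close>
  have D_lim: "AE t in lborel. (\<lambda>n. D (n + N) t) \<longlonglongrightarrow> gumbel_layer k t"
    using LIMSEQ_ignore_initial_segment[OF rescaled_binomial_layer_tendsto[OF m a lim G]]
    by (simp add: D_def)
  have bound: "AE t in lborel. norm (D (n + N) t) \<le> (1 + exp (real k) * real k) * erlang_tail m \<bar>t\<bar>" for n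
    using rescaled_binomial_layer_bound[OF m k, of "n + N" "a (n + N)" G] N[of "n + N"] G by (simp add: D_def)
  note conv = integrable_dominated_convergence2[OF meas w D_lim bound]
    integral_dominated_convergence[OF meas w D_lim bound]
  have "integrable lborel (D n)" if "n \<ge> N" for n
    using conv(1)[of "n - N"] that by simp
  then show "\<forall>\<^sub>F n in sequentially. integrable lborel (D n)"
    by (auto simp: eventually_sequentially)
  show "(\<lambda>n. integral\<^sup>L lborel (D n)) \<longlonglongrightarrow> integral\<^sup>L lborel (gumbel_layer k)"
    using conv(2) by (rule LIMSEQ_offset)
qed

section \<open>Law of the order statistics\<close>

text \<open>A translated Gamma integral, needed twice below: \<open>k = 0\<close> writes a Gaussian
  weight as an integral, and \<open>k = 1\<close> integrates an annulus area against
  \<open>exp (- s)\<close>.\<close>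

lemma nn_integral_shifted_power_times_exp:
  "(\<integral>\<^sup>+s. ennreal ((s - a) ^ k * exp (- s)) * indicator {a..} s \<partial>lborel) = ennreal (exp (- a) * fact k)"
proof -
  have "(\<integral>\<^sup>+s. ennreal ((s - a) ^ k * exp (- s)) * indicator {a..} s \<partial>lborel)
      = ennreal \<bar>1\<bar> * (\<integral>\<^sup>+s. ennreal ((a + 1 * s - a) ^ k * exp (- (a + 1 * s))) * indicator {a..} (a + 1 * s) \<partial>lborel)"
    by (rule nn_integral_real_affine) auto
  also have "\<dots> = (\<integral>\<^sup>+s. ennreal (exp (- a)) * (ennreal (s ^ k * exp (- s)) * indicator {0..} s) \<partial>lborel)"
    by (auto intro!: nn_integral_cong simp: indicator_def ennreal_mult'[symmetric] exp_diff exp_minus field_simps)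
  also have "\<dots> = ennreal (exp (- a)) * ennreal (fact k)"
    by (subst nn_integral_cmult) (auto simp: nn_intergal_power_times_exp_Ici)
  finally show ?thesis by (simp add: ennreal_mult')
qed

lemma emeasure_complex_annulus:
  assumes "0 \<le> a" "a \<le> s"
  shows "emeasure lborel {z::complex. a < (cmod z)\<^sup>2 \<and> (cmod z)\<^sup>2 \<le> s} = ennreal (pi * (s - a))"
proof -
  have "{z::complex. a < (cmod z)\<^sup>2 \<and> (cmod z)\<^sup>2 \<le> s} = cball 0 (sqrt s) - cball 0 (sqrt a)"
  proof -
    have "cmod z \<le> sqrt c \<longleftrightarrow> (cmod z)\<^sup>2 \<le> c" for z c
      using real_sqrt_le_iff[of "(cmod z)\<^sup>2" c] by simp
    then show ?thesis by auto
  qed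
  moreover have "emeasure lborel (cball 0 (sqrt s) - cball 0 (sqrt a) :: complex set)
      = ennreal (pi * s) - ennreal (pi * a)"
    using assms by (subst emeasure_Diff) (auto simp: emeasure_cball unit_ball_vol_2 intro: order_trans[OF _ real_sqrt_le_mono])
  ultimately show ?thesis
    using assms by (simp add: ennreal_minus algebra_simps)
qed

lemma (in prob_space) cn01_cmod_power2_distributed:
  assumes h: "distributed M lborel h cn01_density"
  shows "distributed M lborel (\<lambda>\<omega>. (cmod (h \<omega>))\<^sup>2) (exponential_density 1)"
proof (rule exponential_distributedI)
  have h_meas [measurable]: "h \<in> borel_measurable M"
    using distributed_measurable[OF h] by simp
  show "(\<lambda>\<omega>. (cmod (h \<omega>))\<^sup>2) \<in> borel_measurable M" by measurable
  fix a :: real assume a: "0 \<le> a"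
  \<comment> \<open>Writing \<open>exp (- r)\<close> as the integral of \<open>exp (- s)\<close> over \<open>s \<ge> r\<close> reduces the Gaussian
    integral to the area of an annulus.\<close>
  define f where "f = (\<lambda>(s::real) (z::complex). ennreal (exp (- s) / pi) *
    indicator {z. a < (cmod z)\<^sup>2 \<and> (cmod z)\<^sup>2 \<le> s} z)"
  have [measurable]: "case_prod f \<in> borel_measurable (lborel \<Otimes>\<^sub>M lborel)"
  proof -
    have "case_prod f = (\<lambda>(s, z). if a < (cmod z)\<^sup>2 \<and> (cmod z)\<^sup>2 \<le> s then ennreal (exp (- s) / pi) else 0)"
      by (auto simp: f_def fun_eq_iff)
    then show ?thesis by simp
  qed
  have "emeasure M {\<omega> \<in> space M. a < (cmod (h \<omega>))\<^sup>2}
      = emeasure M (h -` {z. a < (cmod z)\<^sup>2} \<inter> space M)"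
    by (rule arg_cong[where f = "emeasure M"]) auto
  also have "\<dots> = (\<integral>\<^sup>+z. cn01_density z * indicator {z. a < (cmod z)\<^sup>2} z \<partial>lborel)"
    by (rule distributed_emeasure[OF h]) measurable
  also have "\<dots> = (\<integral>\<^sup>+z. (\<integral>\<^sup>+s. f s z \<partial>lborel) \<partial>lborel)"
  proof (intro nn_integral_cong)
    fix z :: complex
    have "(\<integral>\<^sup>+s. f s z \<partial>lborel) = (\<integral>\<^sup>+s. (ennreal (1 / pi) * indicator {z. a < (cmod z)\<^sup>2} z) *
        (ennreal ((s - (cmod z)\<^sup>2) ^ 0 * exp (- s)) * indicator {(cmod z)\<^sup>2..} s) \<partial>lborel)"
      by (intro nn_integral_cong) (auto simp: f_def indicator_def ennreal_mult'[symmetric])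
    also have "\<dots> = (ennreal (1 / pi) * indicator {z. a < (cmod z)\<^sup>2} z) * ennreal (exp (- (cmod z)\<^sup>2) * fact 0)"
      by (subst nn_integral_cmult) (auto simp: nn_integral_shifted_power_times_exp simp del: power_0)
    finally show "cn01_density z * indicator {z. a < (cmod z)\<^sup>2} z = (\<integral>\<^sup>+s. f s z \<partial>lborel)"
      by (auto simp: cn01_density_def indicator_def ennreal_mult'[symmetric])
  qed
  \<comment> \<open>Integrating over \<open>z\<close> first leaves the area
    \<open>pi * (s - a)\<close>, whose factor \<open>pi\<close> cancels the normalisation of the
    Gaussian density.\<close>
  also have "\<dots> = (\<integral>\<^sup>+s. (\<integral>\<^sup>+z. f s z \<partial>lborel) \<partial>lborel)"
    by (rule lborel_pair.Fubini') measurable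
  also have "\<dots> = (\<integral>\<^sup>+s. ennreal ((s - a) ^ 1 * exp (- s)) * indicator {a..} s \<partial>lborel)"
  proof (intro nn_integral_cong)
    fix s :: real
    have "(\<integral>\<^sup>+z. f s z \<partial>lborel) = ennreal (exp (- s) / pi) *
        emeasure lborel {z::complex. a < (cmod z)\<^sup>2 \<and> (cmod z)\<^sup>2 \<le> s}"
      unfolding f_def by (subst nn_integral_cmult_indicator) auto
    also have "\<dots> = ennreal ((s - a) ^ 1 * exp (- s)) * indicator {a..} s"
    proof (cases "a \<le> s")
      case True
      then show ?thesis using a
        by (simp add: emeasure_complex_annulus ennreal_mult'[symmetric] mult_ac)
    next
      case False
      then have "{z::complex. a < (cmod z)\<^sup>2 \<and> (cmod z)\<^sup>2 \<le> s} = {}" by auto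
      then show ?thesis using False by (simp only: emeasure_empty) simp
    qed
    finally show "(\<integral>\<^sup>+z. f s z \<partial>lborel) = ennreal ((s - a) ^ 1 * exp (- s)) * indicator {a..} s" .
  qed
  also have "\<dots> = ennreal (exp (- a))"
    by (subst nn_integral_shifted_power_times_exp) simp
  finally have gt: "prob {\<omega> \<in> space M. a < (cmod (h \<omega>))\<^sup>2} = exp (- a)"
    by (simp add: emeasure_eq_measure)
  have "{\<omega> \<in> space M. (cmod (h \<omega>))\<^sup>2 \<le> a} = space M - {\<omega> \<in> space M. a < (cmod (h \<omega>))\<^sup>2}"
    by auto
  then have "prob {\<omega> \<in> space M. (cmod (h \<omega>))\<^sup>2 \<le> a} = 1 - exp (- a)"
    using prob_compl[of "{\<omega> \<in> space M. a < (cmod (h \<omega>))\<^sup>2}"] gt by simp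
  then show "emeasure M {\<omega> \<in> space M. (cmod (h \<omega>))\<^sup>2 \<le> a} = 1 - ennreal (exp (- a * 1))"
    by (simp add: emeasure_eq_measure ennreal_minus[symmetric])
qed simp

section \<open>Exceedance counts and sorted lists\<close>

lemma (in prob_space) prob_count_exceedances_less:
  fixes X :: "'i \<Rightarrow> 'a \<Rightarrow> real"
  assumes I: "finite I" "I \<noteq> {}" and indep: "indep_vars (\<lambda>_. borel) X I"
    and p: "\<And>i. i \<in> I \<Longrightarrow> prob {\<omega> \<in> space M. x < X i \<omega>} = p"
  shows "prob {\<omega> \<in> space M. card {i \<in> I. x < X i \<omega>} < k} = binomial_cdf (card I) k p"
proof -
  have [measurable]: "i \<in> I \<Longrightarrow> X i \<in> borel_measurable M" for i
    using indep by (auto simp: indep_vars_def2)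
  define A :: "'i set \<Rightarrow> 'i \<Rightarrow> real set" where "A = (\<lambda>S i. if i \<in> S then {x<..} else {..x})"
  \<comment> \<open>For \<open>S \<subseteq> I\<close>, \<open>E S\<close> says that exactly the
    indices in \<open>S\<close> exceed \<open>x\<close>, so these events are disjoint. Since
    \<open>I\<close> is nonempty, the intersection stays inside \<open>space M\<close>.\<close>
  define E where "E = (\<lambda>S. \<Inter>i\<in>I. X i -` A S i \<inter> space M)"
  define \<S> where "\<S> = {S. S \<subseteq> I \<and> card S < k}"
  have fin: "finite \<S>" using I by (simp add: \<S>_def)
  have E_iff: "\<omega> \<in> E S \<longleftrightarrow> \<omega> \<in> space M \<and> {i \<in> I. x < X i \<omega>} = S" if "S \<subseteq> I" for \<omega> S
    using that I(2) by (auto simp: E_def A_def not_less split: if_splits)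
  have meas: "E S \<in> events" for S
    unfolding E_def A_def using I by (intro sets.finite_INT) auto
  have gt: "prob (X i -` {x<..} \<inter> space M) = p" if "i \<in> I" for i
    using p[OF that] by (simp add: vimage_def Int_def conj_commute)
  have le: "prob (X i -` {..x} \<inter> space M) = 1 - p" if "i \<in> I" for i
  proof -
    have "X i -` {..x} \<inter> space M = space M - (X i -` {x<..} \<inter> space M)" by auto
    then show ?thesis
      using prob_compl[of "X i -` {x<..} \<inter> space M"] gt[OF that] that by simp
  qed
  have prob_E: "prob (E S) = p ^ card S * (1 - p) ^ (card I - card S)" if "S \<subseteq> I" for S
  proof -
    have "prob (E S) = (\<Prod>i\<in>I. prob (X i -` A S i \<inter> space M))"
      unfolding E_def by (rule indep_varsD_finite[OF indep I(2,1)]) (simp add: A_def)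
    also have "\<dots> = (\<Prod>i\<in>I. if i \<in> S then p else 1 - p)"
      by (intro prod.cong) (auto simp: A_def gt le)
    also have "\<dots> = p ^ card S * (1 - p) ^ card (I - S)"
      using I that by (simp add: prod.If_cases Int_absorb1 Diff_eq)
    finally show ?thesis using I that by (simp add: card_Diff_subset finite_subset)
  qed
  have "{\<omega> \<in> space M. card {i \<in> I. x < X i \<omega>} < k} = (\<Union>S\<in>\<S>. E S)"
    by (auto simp: \<S>_def E_iff)
  also have "prob \<dots> = (\<Sum>S\<in>\<S>. prob (E S))"
  proof (rule finite_measure_finite_Union[OF fin])
    show "disjoint_family_on E \<S>"
      unfolding disjoint_family_on_def by (auto simp: \<S>_def E_iff)
  qed (use meas in auto)
  also have "\<dots> = (\<Sum>j<k. \<Sum>S\<in>{S \<in> \<S>. card S = j}. prob (E S))"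
    by (rule sum.group[symmetric]) (use fin in \<open>auto simp: \<S>_def\<close>)
  also have "\<dots> = (\<Sum>j<k. real (card I choose j) * p ^ j * (1 - p) ^ (card I - j))"
  proof (rule sum.cong[OF refl])
    fix j assume "j \<in> {..<k}"
    then have "{S \<in> \<S>. card S = j} = {S. S \<subseteq> I \<and> card S = j}"
      by (auto simp: \<S>_def)
    then show "(\<Sum>S\<in>{S \<in> \<S>. card S = j}. prob (E S))
        = real (card I choose j) * p ^ j * (1 - p) ^ (card I - j)"
      using n_subsets[OF I(1), of j] by (simp add: prob_E)
  qed
  finally show ?thesis by (simp add: binomial_cdf_def)
qed

text \<open>In a nonincreasing list the entries above \<open>x\<close> form an initial segment, so
  filtering agrees with \<open>takeWhile\<close>. Positions count from 0: position \<open>k\<close>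
  holds the entry of rank \<open>k + 1\<close> from the top.\<close>

lemma less_nth_rev_sort_iff:
  fixes xs :: "'b::linorder list"
  assumes "k < length xs"
  shows "x < rev (sort xs) ! k \<longleftrightarrow> k < length (filter (\<lambda>y. x < y) xs)"
proof -
  define ys where "ys = rev (sort xs)"
  have "length (filter (\<lambda>y. x < y) xs) = length (filter (\<lambda>y. x < y) ys)"
    by (metis mset_filter mset_rev mset_sort size_mset ys_def)
  also have "filter (\<lambda>y. x < y) ys = takeWhile (\<lambda>y. x < y) ys"
    using filter_equals_takeWhile_sorted_rev[of id ys x] by (simp add: ys_def)
  finally have eq: "length (filter (\<lambda>y. x < y) xs) = length (takeWhile (\<lambda>y. x < y) ys)" .
  have "k < length ys" using assms by (simp add: ys_def)
  have "x < ys ! k \<longleftrightarrow> k < length (takeWhile (\<lambda>y. x < y) ys)"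
  proof
    assume "k < length (takeWhile (\<lambda>y. x < y) ys)"
    then show "x < ys ! k"
      by (metis nth_mem set_takeWhileD takeWhile_nth)
  next
    assume gt: "x < ys ! k"
    show "k < length (takeWhile (\<lambda>y. x < y) ys)"
    proof (rule ccontr)
      assume *: "\<not> k < length (takeWhile (\<lambda>y. x < y) ys)"
      define j where "j = length (takeWhile (\<lambda>y. x < y) ys)"
      have "j \<le> k" using * by (simp add: j_def)
      then have "ys ! k \<le> ys ! j"
        using \<open>k < length ys\<close> sorted_rev_nth_mono[of ys j k] by (simp add: ys_def)
      moreover have "\<not> x < ys ! j"
        using \<open>j \<le> k\<close> \<open>k < length ys\<close> nth_length_takeWhile[of "\<lambda>y. x < y" ys] by (simp add: j_def)
      ultimately show False using gt by simp
    qed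
  qed
  then show ?thesis by (simp add: eq ys_def)
qed

lemma less_order_stat_iff:
  fixes X :: "nat \<Rightarrow> 'b::linorder"
  assumes "k < n"
  shows "x < rev (sort (map X [1..<n + 1])) ! k \<longleftrightarrow> k < card {i \<in> {1..n}. x < X i}"
proof -
  have "length (filter (\<lambda>y. x < y) (map X [1..<n + 1])) = card (set (filter (\<lambda>i. x < X i) [1..<n + 1]))"
    by (subst distinct_card) (auto simp: filter_map o_def)
  also have "set (filter (\<lambda>i. x < X i) [1..<n + 1]) = {i \<in> {1..n}. x < X i}"
    by auto
  finally show ?thesis
    using assms by (subst less_nth_rev_sort_iff) auto
qed

lemma top_sum_eq_sum_nth:
  "l \<le> length xs \<Longrightarrow> top_sum l xs = (\<Sum>k<l. rev (sort xs) ! k)"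
  unfolding top_sum_def by (subst sum_list_sum_nth) (auto simp: atLeast0LessThan)

lemma (in prob_space) order_stat:
  fixes X :: "nat \<Rightarrow> 'a \<Rightarrow> real"
  assumes indep: "indep_vars (\<lambda>_. borel) X {1..n}" and k: "k < n"
    and G: "\<And>i x. i \<in> {1..n} \<Longrightarrow> prob {\<omega> \<in> space M. x < X i \<omega>} = G x"
  defines "Y \<equiv> \<lambda>\<omega>. rev (sort (map (\<lambda>i. X i \<omega>) [1..<n + 1])) ! k"
  shows "random_variable borel Y"
    and "prob {\<omega> \<in> space M. x < Y \<omega>} = 1 - binomial_cdf n (Suc k) (G x)"
proof -
  have [measurable]: "i \<in> {1..n} \<Longrightarrow> X i \<in> borel_measurable M" for i
    using indep by (auto simp: indep_vars_def2)
  have Y: "x < Y \<omega> \<longleftrightarrow> \<not> card {i \<in> {1..n}. x < X i \<omega>} < Suc k" for x \<omega>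
    using less_order_stat_iff[OF k, of x "\<lambda>i. X i \<omega>"] by (auto simp: Y_def)
  \<comment> \<open>As a finite sum of indicators the count is measurable; the sets
    \<open>x < Y\<close> are complements of count events, which makes \<open>Y\<close> measurable
    without analysing sorting itself.\<close>
  have card_sum: "card {i \<in> {1..n}. x < X i \<omega>} = (\<Sum>i\<in>{1..n}. if x < X i \<omega> then 1 else 0)" for x \<omega>
    by (simp add: sum.If_cases Int_def)
  have ev: "{\<omega> \<in> space M. card {i \<in> {1..n}. x < X i \<omega>} < Suc k} \<in> events" for x
    unfolding card_sum by measurable
  have eq: "{\<omega> \<in> space M. x < Y \<omega>} = space M - {\<omega> \<in> space M. card {i \<in> {1..n}. x < X i \<omega>} < Suc k}" for x
    by (auto simp: Y)
  show "random_variable borel Y"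
    using ev by (simp add: borel_measurable_iff_greater eq)
  show "prob {\<omega> \<in> space M. x < Y \<omega>} = 1 - binomial_cdf n (Suc k) (G x)"
    unfolding eq using prob_compl[OF ev]
      prob_count_exceedances_less[OF _ _ indep, of x "G x" "Suc k"] G k by simp
qed

text \<open>Collects the corrections of the \<open>l\<close> top ranks; the term
  \<open>- real l\<close> becomes the \<open>+ 1\<close> inside the limit.\<close>

lemma sum_harmonic: "(\<Sum>k<l. \<Sum>i=1..k. 1 / real i) = real l * (\<Sum>i=1..l. 1 / real i) - real l"
proof (induction l)
  case (Suc l)
  have "real (Suc l) * (1 / real (Suc l)) = 1" by simp
  then show ?case using Suc by (simp add: algebra_simps del: of_nat_Suc) (simp add: algebra_simps)
qed simp

text \<open>Continuity yields a point \<open>c\<close> with tail exactly \<open>1 / n\<close>, and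
  strict monotonicity makes the set equal to \<open>{c..}\<close>. With \<open>n \<ge> 2\<close> the
  level is below 1, which excludes negative \<open>x\<close>; for \<open>n = 1\<close> the set would
  be the whole line. The logarithmic bound, from \<open>exp (- c) \<le> erlang_tail m c\<close>,
  later forces \<open>a n\<close> to infinity.\<close>

lemma erlang_quantile:
  assumes m: "m \<ge> 1" and n: "n \<ge> 2"
  defines "q \<equiv> Inf {x. (if x < 0 then 1 else erlang_tail m x) \<le> 1 / real n}"
  shows "erlang_tail m q = 1 / real n" and "ln (real n) \<le> q"
proof -
  have pos: "0 < 1 / real n" "1 / real n < 1" using n by auto
  have "\<forall>\<^sub>F x in at_top. erlang_tail m x < 1 / real n"
    by (rule order_tendstoD(2)[OF erlang_tail_tendsto_0 pos(1)])
  then have "\<forall>\<^sub>F x in at_top. erlang_tail m x < 1 / real n \<and> 0 \<le> x"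
    using eventually_ge_at_top[of 0] by (rule eventually_conj)
  then obtain y where y: "erlang_tail m y < 1 / real n" "0 \<le> y"
    by (auto dest: eventually_happens)
  have "\<exists>c\<ge>0. c \<le> y \<and> erlang_tail m c = 1 / real n"
    using y pos erlang_tail_at_0[OF m] by (intro IVT2) (auto intro: isCont_erlang_tail)
  then obtain c where c: "c \<ge> 0" "erlang_tail m c = 1 / real n" by blast
  have "{x. (if x < 0 then 1 else erlang_tail m x) \<le> 1 / real n} = {c..}"
  proof (intro set_eqI iffI; simp only: mem_Collect_eq atLeast_iff)
    fix x assume x: "(if x < 0 then 1 else erlang_tail m x) \<le> 1 / real n"
    then have "x \<ge> 0" using pos by (simp split: if_splits)
    then show "c \<le> x" using x c erlang_tail_strict_antimono[OF m, of x c] by force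
  next
    fix x assume "c \<le> x"
    then show "(if x < 0 then 1 else erlang_tail m x) \<le> 1 / real n"
      using c erlang_tail_antimono[of c x m] by simp
  qed
  then have q: "q = c" by (simp add: q_def)
  show "erlang_tail m q = 1 / real n" by (simp add: q c)
  have "exp (- c) \<le> 1 / real n" using exp_le_erlang_tail[OF m c(1)] c(2) by simp
  then have "ln (exp (- c)) \<le> ln (1 / real n)" using pos by (subst ln_le_cancel_iff) auto
  then show "ln (real n) \<le> q" using n by (simp add: q ln_div)
qed

lemma (in prob_space) sum_cmod_power2_indep_tail:
  fixes h :: "nat \<Rightarrow> nat \<Rightarrow> 'a \<Rightarrow> complex"
  assumes L: "L \<ge> 1"
    and indep: "indep_vars (\<lambda>_. borel) (\<lambda>(i, j). h i j) (UNIV \<times> {1..L})"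
    and h: "\<And>i j. j \<in> {1..L} \<Longrightarrow> distributed M lborel (h i j) cn01_density"
  defines "X \<equiv> \<lambda>i \<omega>. \<Sum>j = 1..L. (cmod (h i j \<omega>))\<^sup>2"
  shows "indep_vars (\<lambda>_. borel) X UNIV"
    and "prob {\<omega> \<in> space M. x < X i \<omega>} = (if x < 0 then 1 else erlang_tail L x)"
proof -
  have sq: "indep_vars (\<lambda>_. borel) (\<lambda>p \<omega>. (cmod ((\<lambda>(i, j). h i j) p \<omega>))\<^sup>2) (UNIV \<times> {1..L})"
    by (rule indep_vars_compose2[OF indep]) simp
  \<comment> \<open>The pairs are grouped into the disjoint blocks
    \<open>{i} \<times> {1..L}\<close>, and each \<open>X i\<close> is a measurable function of its
    own block.\<close>
  have "indep_vars (\<lambda>i. PiM ({i} \<times> {1..L}) (\<lambda>_. borel))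
      (\<lambda>i \<omega>. restrict (\<lambda>p. (cmod ((\<lambda>(i, j). h i j) p \<omega>))\<^sup>2) ({i} \<times> {1..L})) UNIV"
    by (rule indep_vars_restrict[OF sq]) (auto simp: disjoint_family_on_def)
  then have "indep_vars (\<lambda>_. borel) (\<lambda>i \<omega>. (\<lambda>f. \<Sum>j = 1..L. f (i, j))
      (restrict (\<lambda>p. (cmod ((\<lambda>(i, j). h i j) p \<omega>))\<^sup>2) ({i} \<times> {1..L}))) UNIV"
    by (rule indep_vars_compose2)
       (auto intro!: borel_measurable_sum measurable_component_singleton)
  also have "(\<lambda>i \<omega>. (\<lambda>f. \<Sum>j = 1..L. f (i, j))
      (restrict (\<lambda>p. (cmod ((\<lambda>(i, j). h i j) p \<omega>))\<^sup>2) ({i} \<times> {1..L}))) = X"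
    unfolding X_def by (intro ext sum.cong) auto
  finally show "indep_vars (\<lambda>_. borel) X UNIV" .
  have exp: "distributed M lborel (\<lambda>\<omega>. (cmod (h i j \<omega>))\<^sup>2) (exponential_density 1)" if "j \<in> {1..L}" for j
    by (rule cn01_cmod_power2_distributed[OF h[OF that]])
  have "indep_vars (\<lambda>_. borel) (\<lambda>p \<omega>. (cmod ((\<lambda>(i, j). h i j) p \<omega>))\<^sup>2) ({i} \<times> {1..L})"
    by (rule indep_vars_subset[OF sq]) auto
  \<comment> \<open>\<open>erlang_density k\<close> has shape \<open>k + 1\<close>, so
    \<open>L\<close> exponential summands give index \<open>L - 1\<close>.\<close>
  then have dist: "distributed M lborel (\<lambda>\<omega>. \<Sum>p\<in>{i} \<times> {1..L}. (cmod ((\<lambda>(i, j). h i j) p \<omega>))\<^sup>2)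
      (erlang_density (card ({i} \<times> {1..L}) - 1) 1)"
    using L exp by (intro exponential_distributed_sum) auto
  have "(\<Sum>p\<in>{i} \<times> {1..L}. (cmod ((\<lambda>(i, j). h i j) p \<omega>))\<^sup>2) = X i \<omega>" for \<omega>
    using sum.cartesian_product[of "\<lambda>i j. (cmod (h i j \<omega>))\<^sup>2" "{1..L}" "{i}"]
    by (simp add: X_def case_prod_unfold)
  with dist have dist: "distributed M lborel (X i) (erlang_density (L - 1) 1)"
    by (simp add: card_cartesian_product)
  show "prob {\<omega> \<in> space M. x < X i \<omega>} = (if x < 0 then 1 else erlang_tail L x)"
  proof (cases "x < 0")
    case True
    have "X i \<omega> \<ge> 0" for \<omega> by (simp add: X_def sum_nonneg)
    then have "{\<omega> \<in> space M. x < X i \<omega>} = space M"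
      using True by (auto intro: less_le_trans)
    then show ?thesis using True by (simp add: prob_space)
  next
    case False
    have "{..L - 1} = {..<L}" using L by auto
    then show ?thesis
      using erlang_distributed_gt[OF dist, of x] False
      by (simp add: erlang_CDF_def erlang_tail_def sum_distrib_left mult.commute)
  qed
qed

theorem theorem1:
  fixes M :: "'a measure" and h :: "nat \<Rightarrow> nat \<Rightarrow> 'a \<Rightarrow> complex"
    and L l :: nat
    and X :: "nat \<Rightarrow> 'a \<Rightarrow> real" and F :: "real \<Rightarrow> real"
    and a b :: "nat \<Rightarrow> real"
  assumes "prob_space M"
    and "L \<ge> 1" and "l \<ge> 1"
    and "prob_space.indep_vars M (\<lambda>_. borel) (\<lambda>(i, j). h i j) (UNIV \<times> {1..L})"
    and "\<And>i j. j \<in> {1..L} \<Longrightarrow> distributed M lborel (h i j) cn01_density"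
    and "\<And>i. X i = (\<lambda>\<omega>. \<Sum>j = 1..L. (cmod (h i j \<omega>))\<^sup>2)"
    and "\<And>x. F x = measure M {\<omega> \<in> space M. X 1 \<omega> \<le> x}"
    and "\<And>n. a n = Inf {x. 1 - F x \<le> 1 / real n}"
    and "\<And>n. b n = (\<Sum>i = 0..L - 1. real (L - i) / fact i * a n ^ i)
                   / (\<Sum>i = 0..L - 1. 1 / fact i * a n ^ i)"
  shows "(\<lambda>n. prob_space.expectation M
            (\<lambda>\<omega>. (top_sum l (map (\<lambda>i. X i \<omega>) [1..<n + 1]) - real l * a n) / b n))
         \<longlonglongrightarrow> real l * (mu1x + 1 - (\<Sum>k = 1..l. 1 / real k))"
proof -
  interpret prob_space M by fact
  define G where "G = (\<lambda>x. if x < 0 then 1 else erlang_tail L x)"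
  have X: "X = (\<lambda>i \<omega>. \<Sum>j = 1..L. (cmod (h i j \<omega>))\<^sup>2)"
    using assms(6) by auto
  have indep: "indep_vars (\<lambda>_. borel) X UNIV"
    and tail: "prob {\<omega> \<in> space M. x < X i \<omega>} = G x" for i x
    using sum_cmod_power2_indep_tail[OF assms(2,4,5)] by (auto simp: X G_def)
  have X_meas [measurable]: "X i \<in> borel_measurable M" for i
    using indep by (auto simp: indep_vars_def2)
  have F: "1 - F x = G x" for x
  proof -
    have "{\<omega> \<in> space M. x < X 1 \<omega>} = space M - {\<omega> \<in> space M. X 1 \<omega> \<le> x}" by auto
    then show ?thesis
      using prob_compl[of "{\<omega> \<in> space M. X 1 \<omega> \<le> x}"] tail[of x 1] by (simp add: assms(7))
  qed
  have quantile: "erlang_tail L (a n) = 1 / real n" "ln (real n) \<le> a n" if "n \<ge> 2" for n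
    using erlang_quantile[OF assms(2) that] by (simp_all add: assms(8) F G_def)
  have a_tail: "\<forall>\<^sub>F n in sequentially. erlang_tail L (a n) = 1 / real n"
    using eventually_ge_at_top[of 2] by eventually_elim (rule quantile)
  have a_lim: "filterlim a at_top sequentially"
  proof (rule filterlim_at_top_mono)
    show "filterlim (\<lambda>n. ln (real n)) at_top sequentially"
      by (intro filterlim_compose[OF ln_at_top] filterlim_real_sequentially)
    show "\<forall>\<^sub>F n in sequentially. ln (real n) \<le> a n"
      using eventually_ge_at_top[of 2] by eventually_elim (rule quantile)
  qed
  have b_lim: "b \<longlonglongrightarrow> 1"
  proof -
    have "{0..L - 1} = {..<Suc (L - 1)}" by auto
    then have "b = (\<lambda>n. (\<Sum>i<Suc (L - 1). real (L - i) / fact i * a n ^ i)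
        / (\<Sum>i<Suc (L - 1). 1 / fact i * a n ^ i))"
      using assms(9) by (simp add: fun_eq_iff)
    \<comment> \<open>At the top index \<open>i = L - 1\<close> the factor \<open>L - i\<close> is
      1, so numerator and denominator share the leading coefficient.\<close>
    moreover have "((\<lambda>x. (\<Sum>i<Suc (L - 1). real (L - i) / fact i * x ^ i)
        / (\<Sum>i<Suc (L - 1). 1 / fact i * x ^ i)) \<longlongrightarrow> 1) at_top"
      using assms(2) by (intro polynomial_ratio_tendsto_1) auto
    ultimately show ?thesis
      using filterlim_compose[OF _ a_lim] by simp
  qed
  \<comment> \<open>Here \<open>k\<close> counts from 0, so \<open>Y k n\<close> has rank
    \<open>k + 1\<close> from the top; hence \<open>Suc k\<close> in \<open>D\<close>, and a
    harmonic sum up to \<open>k\<close> in its limit.\<close>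
  define Y where "Y = (\<lambda>k n \<omega>. rev (sort (map (\<lambda>i. X i \<omega>) [1..<n + 1])) ! k)"
  define D where "D = (\<lambda>k n t. 1 - binomial_cdf n (Suc k) (G (a n + t)) - indicator {..<0} t)"
  have Y: "integrable M (\<lambda>\<omega>. Y k n \<omega> - a n) \<and>
      expectation (\<lambda>\<omega>. Y k n \<omega> - a n) = integral\<^sup>L lborel (D k n)"
    if "k < n" and int: "integrable lborel (D k n)" for k n
  proof -
    have ind: "indep_vars (\<lambda>_. borel) X {1..n}"
      by (rule indep_vars_subset[OF indep]) simp
    have [measurable]: "random_variable borel (Y k n)"
      unfolding Y_def by (rule order_stat[OF ind \<open>k < n\<close> tail])
    have prob_Y: "prob {\<omega> \<in> space M. x < Y k n \<omega>} = 1 - binomial_cdf n (Suc k) (G x)" for x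
      unfolding Y_def by (rule order_stat[OF ind \<open>k < n\<close> tail])
    have eq: "(\<lambda>t. prob {\<omega> \<in> space M. t < Y k n \<omega> - a n} - indicator {..<0} t) = D k n"
      by (simp add: D_def fun_eq_iff less_diff_eq prob_Y add.commute)
    show ?thesis
      using layer_cake[of "\<lambda>\<omega>. Y k n \<omega> - a n"] int by (simp add: eq)
  qed
  note layers = rescaled_binomial_layer_integral[OF assms(2) _ a_tail a_lim G_def]
  have D_int: "\<forall>\<^sub>F n in sequentially. integrable lborel (D k n)" for k
    using layers(1)[of "Suc k"] by (simp add: D_def)
  have D_lim: "(\<lambda>n. integral\<^sup>L lborel (D k n)) \<longlonglongrightarrow> mu1x - (\<Sum>i=1..k. 1 / real i)" for k
    using layers(2)[of "Suc k"] has_bochner_integral_integral_eq[OF gumbel_layer_integral[of k]]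
    by (simp add: D_def)
  have "(\<lambda>n. (\<Sum>k<l. integral\<^sup>L lborel (D k n)) / b n) \<longlonglongrightarrow> (\<Sum>k<l. mu1x - (\<Sum>i=1..k. 1 / real i)) / 1"
    by (intro tendsto_intros D_lim b_lim) auto
  moreover have "(\<Sum>k<l. mu1x - (\<Sum>i=1..k. 1 / real i)) / 1 = real l * (mu1x + 1 - (\<Sum>k = 1..l. 1 / real k))"
    using sum_harmonic[of l] by (simp add: sum_subtractf algebra_simps)
  ultimately have "(\<lambda>n. (\<Sum>k<l. integral\<^sup>L lborel (D k n)) / b n)
      \<longlonglongrightarrow> real l * (mu1x + 1 - (\<Sum>k = 1..l. 1 / real k))" by simp
  then show ?thesis
  proof (rule Lim_transform_eventually)
    \<comment> \<open>Only finitely many ranks occur, so from some \<open>n\<close> on all layers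
      are integrable at once and expectation may be exchanged with the sum.\<close>
    have "\<forall>\<^sub>F n in sequentially. \<forall>k\<in>{..<l}. integrable lborel (D k n)"
      using D_int by (intro eventually_ball_finite) auto
    then show "\<forall>\<^sub>F n in sequentially. (\<Sum>k<l. integral\<^sup>L lborel (D k n)) / b n =
        expectation (\<lambda>\<omega>. (top_sum l (map (\<lambda>i. X i \<omega>) [1..<n + 1]) - real l * a n) / b n)"
      using eventually_ge_at_top[of l]
    proof eventually_elim
      case (elim n)
      have "(\<Sum>k<l. integral\<^sup>L lborel (D k n)) = (\<Sum>k<l. expectation (\<lambda>\<omega>. Y k n \<omega> - a n))"
        using Y elim by (intro sum.cong) auto
      also have "\<dots> = expectation (\<lambda>\<omega>. \<Sum>k<l. Y k n \<omega> - a n)"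
        using Y elim by (intro Bochner_Integration.integral_sum[symmetric]) auto
      also have "(\<lambda>\<omega>. \<Sum>k<l. Y k n \<omega> - a n)
          = (\<lambda>\<omega>. top_sum l (map (\<lambda>i. X i \<omega>) [1..<n + 1]) - real l * a n)"
        using elim by (auto simp: top_sum_eq_sum_nth Y_def sum_subtractf)
      finally show ?case by simp
    qed
  qed
qed

end
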